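(* Let $Z$ be a Banach space and let $(X_n)_{n\in\mathbb{N}_0}$ be a dense subspace chain in $Z$, with associated spaces $J(X_n)\subseteq\hat J(X_n)$. Let $(Z_n)_{n\in\mathbb{N}}$ be an unconditional Schauder decomposition of $Z$ that satisfies a lower $2$-estimate and such that $X_n=\bigoplus_{i=1}^n Z_i$ for every $n$, and let $(T_n)_{n\in\mathbb{N}}$ be the sequence of aggregate projections associated with $(Z_n)_{n\in\mathbb{N}}$ (so that $T_n$ has range $R(T_n)=X_n$ and $T_n(z)\to z$ as $n\to\infty$ for every $z\in Z$). Then the linear map $T\colon Z\to\hat J(X_n)$ defined as $T(z)=(T_n(z))_{n\in\mathbb{N}}$ is well defined and an embedding (an isomorphism onto its range) into $\hat J(X_n)$, and $\hat J(X_n)=J(X_n)\oplus R(T)\simeq J(X_n)\oplus Z$, where $R(T)$ is the range of $T$.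
   Context: Setting. Let $\mathbb{N}_0=\mathbb{N}\cup\{0\}$ and let $\wp$ be the set of all non-empty finite subsets of $\mathbb{N}_0$. Let $(Z,\|\cdot\|)$ be a Banach space. A dense subspace chain is a sequence $(X_n)_{n\in\mathbb{N}_0}$ of closed subspaces of $Z$ with $\dim X_0=0$, $X_n\subseteq X_{n+1}$ for every $n$, and $\bigcup_n X_n$ dense in $Z$; each $X_n$ carries the restriction of $\|\cdot\|$. For $x=(x_n)_{n\in\mathbb{N}_0}\in\prod_{n\in\mathbb{N}_0}X_n$ and $S=\{p_0<\cdots<p_k\}\in\wp$ let $$\rho(x,S)=\Bigl(\sum_{i=1}^k\|x_{p_{i-1}}-x_{p_i}\|^2+\|x_{p_k}\|^2\Bigr)^{1/2},$$ and $\|x\|_J=\frac{1}{\sqrt2}\sup_{S\in\wp}\rho(x,S)$. Let $\hat J(X_n)=\{x\in\prod_{n}X_n:\|x\|_J<\infty\}$, a Banach space with norm $\|\cdot\|_J$, and $J(X_n)=\{(x_n)\in\hat J(X_n):\lim_n\|x_n\|=0\}$, a closed subspace. Since $X_0=0$, the coordinate of index $0$ is always $0$ and sequences may be written as indexed by $\mathbb{N}$. For a Schauder decomposition $(Z_n)_{n\in\mathbb{N}}$ of $Z$ (every $z\in Z$ has a unique expansion $z=\sum_i z_i$ with $z_i\in Z_i$), the aggregate projections are $T_n(\sum_i z_i)=\sum_{i=1}^n z_i$. The decomposition satisfies a lower $2$-estimate if there is $M<\infty$ such that $\sum_{i=1}^k\|z_i\|^2\le M\bigl\|\sum_{i=1}^k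 z_i\bigr\|^2$ whenever $z_1,\dots,z_k\in Z$ are disjoint with respect to $(Z_n)_{n\in\mathbb{N}}$ (i.e. their expansions have pairwise disjoint supports). The symbol $\simeq$ denotes isomorphism of Banach spaces. *)

theory Defs
  imports "HOL-Analysis.Analysis" "HOL-Library.Function_Algebras"
begin

section \<open>Pointwise real vector space structure on functions\<close>

instantiation "fun" :: (type, scaleR) scaleR
begin

definition scaleR_fun :: "real \<Rightarrow> ('a \<Rightarrow> 'b) \<Rightarrow> 'a \<Rightarrow> 'b" where
  "scaleR_fun r f = (\<lambda>x. r *\<^sub>R f x)"

instance ..

end

instance "fun" :: (type, real_vector) real_vector
  by standard
    (simp_all add: scaleR_fun_def plus_fun_def fun_eq_iff scaleR_add_right scaleR_add_left)

section \<open>Normed spaces with explicit carrier and norm\<close>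

text \<open>
  The spaces below depend on a term (the chain \<open>X\<close>), so they cannot be types.  A normed space is
  a pair of a subset \<open>S\<close> of a real vector space and a function \<open>N\<close>, of which only the values on
  \<open>S\<close> matter.
\<close>

definition bounded_linear_between ::
  "'v::real_vector set \<Rightarrow> ('v \<Rightarrow> real) \<Rightarrow> 'w::real_vector set \<Rightarrow> ('w \<Rightarrow> real) \<Rightarrow> ('v \<Rightarrow> 'w) \<Rightarrow> bool"
where
  "bounded_linear_between S N S' N' f \<longleftrightarrow>
     (\<forall>x\<in>S. f x \<in> S') \<and>
     (\<forall>x\<in>S. \<forall>y\<in>S. f (x + y) = f x + f y) \<and>
     (\<forall>c. \<forall>x\<in>S. f (c *\<^sub>R x) = c *\<^sub>R f x) \<and>
     (\<exists>K. \<forall>x\<in>S. N' (f x) \<le> K * N x)"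

definition normed_isomorphism ::
  "'v::real_vector set \<Rightarrow> ('v \<Rightarrow> real) \<Rightarrow> 'w::real_vector set \<Rightarrow> ('w \<Rightarrow> real) \<Rightarrow> ('v \<Rightarrow> 'w) \<Rightarrow> bool"
where
  "normed_isomorphism S N S' N' f \<longleftrightarrow>
     bij_betw f S S' \<and>
     bounded_linear_between S N S' N' f \<and>
     bounded_linear_between S' N' S N (inv_into S f)"

definition normed_isomorphic ::
  "'v::real_vector set \<Rightarrow> ('v \<Rightarrow> real) \<Rightarrow> 'w::real_vector set \<Rightarrow> ('w \<Rightarrow> real) \<Rightarrow> bool"
where
  "normed_isomorphic S N S' N' \<longleftrightarrow> (\<exists>f. normed_isomorphism S N S' N' f)"

definition normed_embedding ::
  "'v::real_vector set \<Rightarrow> ('v \<Rightarrow> real) \<Rightarrow> 'w::real_vector set \<Rightarrow> ('w \<Rightarrow> real) \<Rightarrow> ('v \<Rightarrow> 'w) \<Rightarrow> bool"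
where
  "normed_embedding S N S' N' f \<longleftrightarrow>
     bounded_linear_between S N S' N' f \<and> normed_isomorphism S N (f ` S) N' f"

text \<open>
  The norm of an external direct sum.  The space itself is the product of the carriers; up to
  equivalence the choice of product norm is immaterial.
\<close>

definition sum_norm :: "('v \<Rightarrow> real) \<Rightarrow> ('w \<Rightarrow> real) \<Rightarrow> 'v \<times> 'w \<Rightarrow> real" where
  "sum_norm N N' = (\<lambda>(a, b). N a + N' b)"

text \<open>
  Internal direct sum in the category of normed spaces: every element of \<open>S\<close> is uniquely
  \<open>a + b\<close> with \<open>a \<in> A\<close>, \<open>b \<in> B\<close>, and \<open>a\<close>, \<open>b\<close> depend continuously on it.
\<close>

definition topological_direct_sum ::
  "'v::real_vector set \<Rightarrow> ('v \<Rightarrow> real) \<Rightarrow> 'v set \<Rightarrow> 'v set \<Rightarrow> bool"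
where
  "topological_direct_sum S N A B \<longleftrightarrow>
     subspace A \<and> subspace B \<and>
     normed_isomorphism (A \<times> B) (sum_norm N N) S N (\<lambda>(a, b). a + b)"

section \<open>James-type spaces of a dense subspace chain\<close>

text \<open>The condition \<open>dim (X 0) = 0\<close> is written \<open>X 0 = {0}\<close>, since the library's \<open>dim\<close> is also \<open>0\<close>
  on infinite-dimensional spaces.\<close>

definition dense_subspace_chain :: "(nat \<Rightarrow> 'a::real_normed_vector set) \<Rightarrow> bool" where
  "dense_subspace_chain X \<longleftrightarrow>
     (\<forall>n. subspace (X n) \<and> closed (X n)) \<and>
     X 0 = {0} \<and>
     (\<forall>n. X n \<subseteq> X (Suc n)) \<and>
     closure (\<Union>n. X n) = UNIV"

definition finite_index_sets :: "nat set set" where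
  "finite_index_sets = {S. finite S \<and> S \<noteq> {}}"

definition rho :: "(nat \<Rightarrow> 'a::real_normed_vector) \<Rightarrow> nat set \<Rightarrow> real" where
  "rho x S =
     (let p = sorted_list_of_set S; k = card S - 1 in
      sqrt ((\<Sum>i=1..k. (norm (x (p ! (i - 1)) - x (p ! i)))\<^sup>2) + (norm (x (p ! k)))\<^sup>2))"

text \<open>The supremum is only meaningful on \<open>J_hat\<close>, where the set is bounded.\<close>

definition J_norm :: "(nat \<Rightarrow> 'a::real_normed_vector) \<Rightarrow> real" where
  "J_norm x = (1 / sqrt 2) * (SUP S\<in>finite_index_sets. rho x S)"

definition J_hat :: "(nat \<Rightarrow> 'a::real_normed_vector set) \<Rightarrow> (nat \<Rightarrow> 'a) set" where
  "J_hat X = {x. (\<forall>n. x n \<in> X n) \<and> bdd_above (rho x ` finite_index_sets)}"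

definition J_space :: "(nat \<Rightarrow> 'a::real_normed_vector set) \<Rightarrow> (nat \<Rightarrow> 'a) set" where
  "J_space X = {x \<in> J_hat X. (\<lambda>n. norm (x n)) \<longlonglongrightarrow> 0}"

section \<open>Schauder decompositions\<close>

text \<open>
  The decomposition \<open>(Z\<^sub>n)\<close> indexed by \<open>n \<ge> 1\<close> is represented by the sequence \<open>W\<close> indexed from
  \<open>0\<close> with \<open>W i = Z\<^bsub>i+1\<^esub>\<close>.  Thus \<open>Z\<^sub>1, \<dots>, Z\<^sub>n\<close> are the spaces \<open>W i\<close> with \<open>i < n\<close>.
\<close>

definition is_expansion ::
  "(nat \<Rightarrow> 'a::real_normed_vector set) \<Rightarrow> 'a \<Rightarrow> (nat \<Rightarrow> 'a) \<Rightarrow> bool"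
where
  "is_expansion W z w \<longleftrightarrow> (\<forall>i. w i \<in> W i) \<and> w sums z"

definition schauder_decomposition :: "(nat \<Rightarrow> 'a::real_normed_vector set) \<Rightarrow> bool" where
  "schauder_decomposition W \<longleftrightarrow>
     (\<forall>i. subspace (W i) \<and> closed (W i)) \<and> (\<forall>z. \<exists>!w. is_expansion W z w)"

definition expansion :: "(nat \<Rightarrow> 'a::real_normed_vector set) \<Rightarrow> 'a \<Rightarrow> nat \<Rightarrow> 'a" where
  "expansion W z = (THE w. is_expansion W z w)"

text \<open>Unconditional convergence of all expansions: every rearrangement converges.\<close>

definition unconditional_schauder_decomposition ::
  "(nat \<Rightarrow> 'a::real_normed_vector set) \<Rightarrow> bool"
where
  "unconditional_schauder_decomposition W \<longleftrightarrow>
     schauder_decomposition W \<and>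
     (\<forall>z \<pi>. bij \<pi> \<longrightarrow> summable (\<lambda>i. expansion W z (\<pi> i)))"

definition expansion_support :: "(nat \<Rightarrow> 'a::real_normed_vector set) \<Rightarrow> 'a \<Rightarrow> nat set" where
  "expansion_support W z = {i. expansion W z i \<noteq> 0}"

definition lower_2_estimate :: "(nat \<Rightarrow> 'a::real_normed_vector set) \<Rightarrow> bool" where
  "lower_2_estimate W \<longleftrightarrow>
     (\<exists>M::real. \<forall>(k::nat) (z::nat \<Rightarrow> 'a).
        disjoint_family_on (\<lambda>j. expansion_support W (z j)) {1..k} \<longrightarrow>
        (\<Sum>j=1..k. (norm (z j))\<^sup>2) \<le> M * (norm (\<Sum>j=1..k. z j))\<^sup>2)"

text \<open>\<open>Z\<^sub>1 \<oplus> \<dots> \<oplus> Z\<^sub>n\<close>; for a Schauder decomposition the sum is direct because expansions are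
  unique.\<close>

definition block_sum :: "(nat \<Rightarrow> 'a::real_normed_vector set) \<Rightarrow> nat \<Rightarrow> 'a set" where
  "block_sum W n = {\<Sum>i<n. w i | w. \<forall>i<n. w i \<in> W i}"

definition aggregate_projection ::
  "(nat \<Rightarrow> 'a::real_normed_vector set) \<Rightarrow> nat \<Rightarrow> 'a \<Rightarrow> 'a"
where
  "aggregate_projection W n z = (\<Sum>i<n. expansion W z i)"

end

theory Submission
  imports Defs
begin

text \<open>
  Everything rests on the limit map \<open>L x = lim x\<close>.  A sequence of finite \<open>J\<close>-norm has bounded
  quadratic variation along every increasing sequence of indices, so it is Cauchy
  (\<open>J_hat_convergent\<close>) and, \<open>Z\<close> being complete, \<open>L\<close> is defined on all of \<open>J_hat X\<close>.  The one-point
  index sets show that \<open>L\<close> is bounded, and its kernel is \<open>J_space X\<close>.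

  The map \<open>T\<close> sends \<open>z\<close> to the partial sums of its expansion, hence \<open>L (T z) = z\<close>.  For the
  boundedness of \<open>T\<close>, note that the differences of partial sums occurring in \<open>\<rho> (T z) S\<close> are
  projections of \<open>z\<close> onto disjoint blocks of indices.  Completed by the remainder of \<open>z\<close>, these
  blocks add up to \<open>z\<close> itself, so the lower 2-estimate bounds the sum of their squared norms by
  \<open>M (norm z)\<^sup>2\<close> (\<open>lower_2_estimate_blocks\<close>).  The last term of \<open>\<rho>\<close>, a single initial block, is
  bounded in the same way.

  Thus \<open>T\<close> is a bounded linear map with the bounded linear left inverse \<open>L\<close>, so \<open>T\<close> is an embedding
  and \<open>T \<circ> L\<close> is a bounded projection onto its range along the kernel of \<open>L\<close>
  (\<open>direct_sum_of_left_inverse\<close>).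
\<close>

section \<open>Left inverses and complemented ranges\<close>

text \<open>
  For a linear bijection, boundedness of the inverse is a lower bound for the map.
\<close>

lemma normed_isomorphismI:
  fixes f :: "'v::real_vector \<Rightarrow> 'w::real_vector"
  assumes S: "subspace S"
    and bij: "bij_betw f S S'"
    and f: "bounded_linear_between S N S' N' f"
    and below: "\<And>x. x \<in> S \<Longrightarrow> N x \<le> K * N' (f x)"
  shows "normed_isomorphism S N S' N' f"
proof -
  let ?g = "inv_into S f"
  have g_f: "?g (f x) = x" if "x \<in> S" for x
    using bij that by (simp add: bij_betw_inv_into_left)
  have f_g: "?g y \<in> S" "f (?g y) = y" if "y \<in> S'" for y
    using bij that by (auto simp: bij_betw_inv_into_right bij_betw_def inv_into_into)
  have add: "f (x + y) = f x + f y" and scale: "f (c *\<^sub>R x) = c *\<^sub>R f x"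
    if "x \<in> S" "y \<in> S" for x y c
    using f that by (auto simp: bounded_linear_between_def)
  have "?g (x + y) = ?g x + ?g y" if "x \<in> S'" "y \<in> S'" for x y
    using g_f[of "?g x + ?g y"] add[of "?g x" "?g y"] f_g that S by (simp add: subspace_add)
  moreover have "?g (c *\<^sub>R x) = c *\<^sub>R ?g x" if "x \<in> S'" for c x
    using g_f[of "c *\<^sub>R ?g x"] scale[of "?g x" "?g x" c] f_g that S by (simp add: subspace_scale)
  moreover have "N (?g y) \<le> K * N' y" if "y \<in> S'" for y
    using below[of "?g y"] f_g that by simp
  ultimately have "bounded_linear_between S' N' S N ?g"
    using f_g unfolding bounded_linear_between_def by blast
  then show ?thesis
    using bij f by (simp add: normed_isomorphism_def)
qed

lemma normed_isomorphic_sym: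
  assumes S': "subspace S'" and iso: "normed_isomorphic S N S' N'"
  shows "normed_isomorphic S' N' S N"
proof -
  obtain f where bij: "bij_betw f S S'" and f: "bounded_linear_between S N S' N' f"
    and g: "bounded_linear_between S' N' S N (inv_into S f)"
    using iso by (auto simp: normed_isomorphic_def normed_isomorphism_def)
  obtain K where K: "\<And>x. x \<in> S \<Longrightarrow> N' (f x) \<le> K * N x"
    using f unfolding bounded_linear_between_def by blast
  have "N' y \<le> K * N (inv_into S f y)" if "y \<in> S'" for y
    using K[of "inv_into S f y"] bij that
    by (metis bij_betw_def bij_betw_inv_into_right inv_into_into)
  then have "normed_isomorphism S' N' S N (inv_into S f)"
    using S' bij g by (intro normed_isomorphismI[where K = K]) (auto intro: bij_betw_inv_into)
  then show ?thesis
    unfolding normed_isomorphic_def by blast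
qed

text \<open>
  If \<open>L\<close> is a bounded left inverse of \<open>T\<close>, then \<open>T \<circ> L\<close> is a bounded projection.  Every \<open>x\<close> splits
  as \<open>(x - T (L x)) + T (L x)\<close>, and both components are controlled by the norm of \<open>x\<close>.
\<close>

lemma direct_sum_of_left_inverse:
  fixes H :: "'v::real_vector set" and T :: "'a::real_normed_vector \<Rightarrow> 'v"
  assumes H: "subspace H"
    and N_nonneg: "\<And>x. x \<in> H \<Longrightarrow> 0 \<le> N x"
    and N_add: "\<And>x y. x \<in> H \<Longrightarrow> y \<in> H \<Longrightarrow> N (x + y) \<le> N x + N y"
    and N_minus: "\<And>x. N (- x) = N x"
    and T: "bounded_linear_between UNIV norm H N T"
    and L: "bounded_linear_between H N UNIV norm L"
    and left_inverse: "\<And>z. L (T z) = z"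
  shows "normed_embedding UNIV norm H N T"
    and "topological_direct_sum H N {x \<in> H. L x = 0} (range T)"
    and "normed_isomorphic H N ({x \<in> H. L x = 0} \<times> (UNIV :: 'a set)) (sum_norm N norm)"
proof -
  let ?A = "{x \<in> H. L x = 0}"
  have T_H: "T z \<in> H" and T_add: "T (z + z') = T z + T z'" and T_scale: "T (c *\<^sub>R z) = c *\<^sub>R T z"
    for z z' c
    using T by (auto simp: bounded_linear_between_def)
  have L_add: "L (x + y) = L x + L y" and L_scale: "L (c *\<^sub>R x) = c *\<^sub>R L x"
    if "x \<in> H" "y \<in> H" for x y c
    using L that by (auto simp: bounded_linear_between_def)
  have L_0: "L 0 = 0"
    using L_scale[of 0 0 0] subspace_0[OF H] by simp
  have L_minus: "L (- x) = - L x" if "x \<in> H" for x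
    using L_scale[OF that that, of "-1"] by simp
  have L_diff: "L (x - y) = L x - L y" if "x \<in> H" "y \<in> H" for x y
    using L_add[OF \<open>x \<in> H\<close> subspace_neg[OF H \<open>y \<in> H\<close>]] L_minus[OF \<open>y \<in> H\<close>] by simp
  obtain C0 where C0: "\<And>z. N (T z) \<le> C0 * norm z"
    using T unfolding bounded_linear_between_def by blast
  obtain K0 where K0: "\<And>x. x \<in> H \<Longrightarrow> norm (L x) \<le> K0 * N x"
    using L unfolding bounded_linear_between_def by blast
  (* Enlarged constants may multiply inequalities; C \<ge> 1 also dominates the coefficient of N a in
     the bound for N (a + T z). *)
  define C where "C = max 1 C0"
  have C_ge: "C \<ge> 1" and C: "N (T z) \<le> C * norm z" for z
    using C0[of z] mult_right_mono[of C0 C "norm z"] by (auto simp: C_def)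
  define K where "K = max 0 K0"
  have K: "norm (L x) \<le> K * N x" if "x \<in> H" for x
    using K0[OF that] mult_right_mono[of K0 K "N x"] N_nonneg[OF that] by (auto simp: K_def)
  have lin_T: "linear T"
    using T_add T_scale by (rule linearI)
  have inj_T: "inj T"
    using left_inverse by (metis injI)
  have range_T: "subspace (range T)"
    using lin_T by (intro linear_subspace_image) auto
  have A: "subspace ?A"
    using H by (auto simp: subspace_def L_add L_scale L_0)

  have TUNIV: "bounded_linear_between UNIV norm (range T) N T"
    using T by (auto simp: bounded_linear_between_def)
  have "norm z \<le> K * N (T z)" for z
    using K[OF T_H[of z]] by (simp add: left_inverse)
  then have "normed_isomorphism UNIV norm (range T) N T"
    using TUNIV inj_T by (intro normed_isomorphismI[where K = K]) (auto simp: bij_betw_def)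
  then show "normed_embedding UNIV norm H N T"
    using T by (simp add: normed_embedding_def)

  have L_sum: "L (a + T z) = z" if "a \<in> ?A" for a z
    using that T_H[of z] by (simp add: L_add left_inverse)
  have components: "norm z \<le> K * N (a + T z)" "N (T z) \<le> C * K * N (a + T z)"
      "N a \<le> (1 + C * K) * N (a + T z)" if a: "a \<in> ?A" for a z
  proof -
    have sum_H: "a + T z \<in> H"
      using a T_H[of z] H by (simp add: subspace_add)
    show z: "norm z \<le> K * N (a + T z)"
      using K[OF sum_H] L_sum[OF a] by simp
    have "N (T z) \<le> C * norm z" by (rule C)
    also have "\<dots> \<le> C * (K * N (a + T z))"
      using z C_ge by (intro mult_left_mono) auto
    finally show Tz: "N (T z) \<le> C * K * N (a + T z)"
      by (simp add: mult.assoc)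
    have "N ((a + T z) + - T z) \<le> N (a + T z) + N (- T z)"
      using sum_H T_H[of z] H by (intro N_add) (auto intro: subspace_neg)
    then show "N a \<le> (1 + C * K) * N (a + T z)"
      using Tz by (simp add: N_minus algebra_simps)
  qed
  have split: "x - T (L x) \<in> ?A" if "x \<in> H" for x
    using that T_H[of "L x"] H by (simp add: subspace_diff L_diff left_inverse)

  have bij: "bij_betw (\<lambda>(a, z). a + T z) (?A \<times> UNIV) H"
  proof -
    have "inj_on (\<lambda>(a, z). a + T z) (?A \<times> UNIV)"
    proof (rule inj_onI, clarify)
      fix a z a' z'
      assume a: "a \<in> H" "L a = 0" "a' \<in> H" "L a' = 0" and eq: "a + T z = a' + T z'"
      then have "z = z'"
        using L_sum[of a z] L_sum[of a' z'] by simp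
      then show "a = a' \<and> z = z'"
        using eq by simp
    qed
    moreover have "(\<lambda>(a, z). a + T z) ` (?A \<times> UNIV) = H"
    proof
      show "(\<lambda>(a, z). a + T z) ` (?A \<times> UNIV) \<subseteq> H"
        using T_H H by (auto intro: subspace_add)
      show "H \<subseteq> (\<lambda>(a, z). a + T z) ` (?A \<times> UNIV)"
      proof
        fix x assume "x \<in> H"
        then have "(x - T (L x), L x) \<in> ?A \<times> UNIV"
          using split by blast
        then show "x \<in> (\<lambda>(a, z). a + T z) ` (?A \<times> UNIV)"
          by (rule rev_image_eqI) simp
      qed
    qed
    ultimately show ?thesis
      by (simp add: bij_betw_def)
  qed
  have "normed_isomorphism (?A \<times> range T) (sum_norm N N) H N (\<lambda>(a, b). a + b)"
  proof (rule normed_isomorphismI[where K = "1 + 2 * (C * K)"])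
    show "subspace (?A \<times> range T)"
      using A range_T by (rule subspace_Times)
    (* The bijection (a, z) \<mapsto> a + T z factors through (a, b) \<mapsto> a + b, as T is injective. *)
    have "bij_betw (\<lambda>(a, z). (a, T z)) (?A \<times> UNIV) (?A \<times> range T)"
      using inj_T by (auto simp: bij_betw_def inj_on_def)
    moreover have "(\<lambda>(a, b). a + b) \<circ> (\<lambda>(a, z). (a, T z)) = (\<lambda>(a, z). a + T z)"
      by auto
    ultimately show "bij_betw (\<lambda>(a, b). a + b) (?A \<times> range T) H"
      using bij bij_betw_comp_iff by fastforce
    have "N (a + T z) \<le> 1 * (N a + N (T z))" if "a \<in> ?A" for a z
      using N_add[of a "T z"] that T_H[of z] by simp
    then show "bounded_linear_between (?A \<times> range T) (sum_norm N N) H N (\<lambda>(a, b). a + b)"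
      unfolding bounded_linear_between_def sum_norm_def
      using T_H H by (auto simp: scaleR_add_right add_ac intro: subspace_add intro!: exI[of _ 1])
    show "sum_norm N N x \<le> (1 + 2 * (C * K)) * N (case x of (a, b) \<Rightarrow> a + b)"
      if mem: "x \<in> ?A \<times> range T" for x
    proof -
      obtain a z where x: "x = (a, T z)" and a: "a \<in> ?A"
        using mem by blast
      show ?thesis
        using components(2,3)[OF a, of z] by (simp add: x sum_norm_def algebra_simps)
    qed
  qed
  then show "topological_direct_sum H N ?A (range T)"
    using A range_T by (simp add: topological_direct_sum_def)

  have "normed_isomorphism (?A \<times> UNIV) (sum_norm N norm) H N (\<lambda>(a, z). a + T z)"
  proof (rule normed_isomorphismI[where K = "1 + C * K + K"])
    show "subspace (?A \<times> (UNIV :: 'a set))"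
      using A by (intro subspace_Times) auto
    show "bij_betw (\<lambda>(a, z). a + T z) (?A \<times> UNIV) H" by (rule bij)
    have "N (a + T z) \<le> C * (N a + norm z)" if a: "a \<in> ?A" for a z
    proof -
      have "N (a + T z) \<le> N a + N (T z)"
        using N_add[of a "T z"] a T_H[of z] by simp
      moreover have "1 * N a \<le> C * N a"
        using C_ge N_nonneg a by (intro mult_right_mono) auto
      ultimately show ?thesis
        using C[of z] by (simp add: algebra_simps)
    qed
    note bound = this
    show "bounded_linear_between (?A \<times> UNIV) (sum_norm N norm) H N (\<lambda>(a, z). a + T z)"
      unfolding bounded_linear_between_def sum_norm_def
    proof (intro conjI exI[of _ C])
      show "\<forall>x\<in>?A \<times> UNIV. (case x of (a, z) \<Rightarrow> a + T z) \<in> H"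
        using H T_H by (auto intro: subspace_add)
    qed (use bound in \<open>auto simp: T_add T_scale scaleR_add_right add_ac\<close>)
    show "sum_norm N norm x \<le> (1 + C * K + K) * N (case x of (a, z) \<Rightarrow> a + T z)"
      if mem: "x \<in> ?A \<times> UNIV" for x
    proof -
      obtain a z where x: "x = (a, z)" and a: "a \<in> ?A"
        using mem by blast
      show ?thesis
        using components(1,3)[OF a, of z] by (simp add: x sum_norm_def algebra_simps)
    qed
  qed
  then show "normed_isomorphic H N (?A \<times> (UNIV :: 'a set)) (sum_norm N norm)"
    by (intro normed_isomorphic_sym[OF H]) (unfold normed_isomorphic_def, rule exI)
qed

section \<open>The James-type norm\<close>

text \<open>
  The terms of \<open>\<rho> x S\<close> are the norms of vectors that depend linearly on \<open>x\<close>.  The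
  differences have the indices \<open>i \<ge> 1\<close>; giving the index \<open>0\<close> to the value of \<open>x\<close> at the last
  element of \<open>S\<close> makes \<open>\<rho>\<close> an \<open>\<ell>\<^sub>2\<close>-norm over a single index range.
\<close>

definition jump :: "nat set \<Rightarrow> (nat \<Rightarrow> 'a::real_normed_vector) \<Rightarrow> nat \<Rightarrow> 'a" where
  "jump S x i =
     (let p = sorted_list_of_set S in
      if i = 0 then x (p ! (card S - 1)) else x (p ! (i - 1)) - x (p ! i))"

lemma rho_eq_L2_set: "rho x S = L2_set (\<lambda>i. norm (jump S x i)) {0..card S - 1}"
  by (simp add: rho_def L2_set_def jump_def Let_def sum.atLeast_Suc_atMost add.commute)

lemma rho_add: "rho (x + y) S \<le> rho x S + rho y S"
proof -
  have "jump S (x + y) i = jump S x i + jump S y i" for i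
    by (simp add: jump_def Let_def)
  then have "rho (x + y) S \<le> L2_set (\<lambda>i. norm (jump S x i) + norm (jump S y i)) {0..card S - 1}"
    by (auto simp: rho_eq_L2_set intro!: L2_set_mono norm_triangle_ineq)
  also have "\<dots> \<le> rho x S + rho y S"
    unfolding rho_eq_L2_set by (rule L2_set_triangle_ineq)
  finally show ?thesis .
qed

lemma rho_scale: "rho (c *\<^sub>R x) S = \<bar>c\<bar> * rho x S"
proof -
  have "jump S (c *\<^sub>R x) i = c *\<^sub>R jump S x i" for i
    by (simp add: jump_def Let_def scaleR_fun_def scaleR_diff_right)
  then show ?thesis
    by (simp add: rho_eq_L2_set L2_set_right_distrib)
qed

lemma rho_singleton: "rho x {n} = norm (x n)"
  by (simp add: rho_def)

text \<open>
  The index sets that detect a failure of the Cauchy property come as initial segments of an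
  increasing sequence, for which \<open>\<rho>\<close> takes this form.
\<close>

lemma rho_strict_mono:
  fixes p :: "nat \<Rightarrow> nat"
  assumes p: "strict_mono p"
  shows "rho x (p ` {0..k}) =
    sqrt ((\<Sum>i=1..k. (norm (x (p (i - 1)) - x (p i)))\<^sup>2) + (norm (x (p k)))\<^sup>2)"
proof -
  have card: "card (p ` {0..k}) = Suc k"
    using p by (simp add: card_image strict_mono_imp_inj_on)
  have "sorted_wrt (<) (map p [0..<Suc k]) \<and> set (map p [0..<Suc k]) = p ` {0..k}"
    using p by (auto simp: sorted_wrt_map strict_mono_less atLeastLessThanSuc_atLeastAtMost
        simp del: upt_Suc)
  then have "sorted_list_of_set (p ` {0..k}) = map p [0..<Suc k]"
    using card sorted_list_of_set_unique[of "p ` {0..k}" "map p [0..<Suc k]"] by simp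
  with card show ?thesis
    by (simp add: rho_def Let_def less_Suc_eq_le le_diff_conv del: upt_Suc cong: sum.cong_simp)
qed

lemma rho_le_J_norm:
  assumes "x \<in> J_hat X" and "S \<in> finite_index_sets"
  shows "rho x S \<le> sqrt 2 * J_norm x"
  using assms by (auto simp: J_hat_def J_norm_def intro: cSUP_upper)

lemma norm_le_J_norm:
  assumes "x \<in> J_hat X"
  shows "norm (x n) \<le> sqrt 2 * J_norm x"
  using rho_le_J_norm[OF assms, of "{n}"] by (simp add: rho_singleton finite_index_sets_def)

lemma J_norm_le:
  assumes "\<And>S. S \<in> finite_index_sets \<Longrightarrow> rho x S \<le> sqrt 2 * C"
  shows "J_norm x \<le> C"
proof -
  have "finite_index_sets \<noteq> {}"
    by (auto simp: finite_index_sets_def)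
  then have "(SUP S\<in>finite_index_sets. rho x S) \<le> sqrt 2 * C"
    using assms by (intro cSUP_least)
  then show ?thesis
    by (simp add: J_norm_def field_simps)
qed

lemma J_norm_nonneg: "x \<in> J_hat X \<Longrightarrow> 0 \<le> J_norm x"
  using norm_le_J_norm[of x X 0] norm_ge_zero[of "x 0"]
  by (metis order_trans real_sqrt_gt_0_iff zero_less_numeral zero_le_mult_iff linorder_not_le)

lemma J_norm_add:
  assumes "x \<in> J_hat X" and "y \<in> J_hat X"
  shows "J_norm (x + y) \<le> J_norm x + J_norm y"
proof (rule J_norm_le)
  fix S assume "S \<in> finite_index_sets"
  then show "rho (x + y) S \<le> sqrt 2 * (J_norm x + J_norm y)"
    using rho_add[of x y S] rho_le_J_norm[OF assms(1), of S] rho_le_J_norm[OF assms(2), of S]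
    by (simp add: algebra_simps)
qed

lemma J_norm_minus: "J_norm (- x) = J_norm x"
  using rho_scale[of "-1" x] by (simp add: J_norm_def)

lemma subspace_J_hat:
  assumes X: "\<And>n. subspace (X n)"
  shows "subspace (J_hat X)"
proof -
  have bdd: "bdd_above (rho x ` finite_index_sets) \<longleftrightarrow>
      (\<exists>B. \<forall>S\<in>finite_index_sets. rho x S \<le> B)" for x :: "nat \<Rightarrow> 'a"
    by (auto simp: bdd_above_def)
  show ?thesis
  proof (rule subspaceI)
    have "rho (0 :: nat \<Rightarrow> 'a) S \<le> 0" for S
      using rho_scale[of 0 "0 :: nat \<Rightarrow> 'a" S] by simp
    then show "0 \<in> J_hat X"
      using X by (auto simp: J_hat_def bdd subspace_0)
  next
    fix x y assume xy: "x \<in> J_hat X" "y \<in> J_hat X"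
    have "rho (x + y) S \<le> sqrt 2 * J_norm x + sqrt 2 * J_norm y" if "S \<in> finite_index_sets" for S
      using rho_add[of x y S] rho_le_J_norm xy that by (meson add_mono order_trans)
    then show "x + y \<in> J_hat X"
      using xy X unfolding J_hat_def bdd by (auto intro: subspace_add)
  next
    fix c x assume x: "x \<in> J_hat X"
    have "rho (c *\<^sub>R x) S \<le> \<bar>c\<bar> * (sqrt 2 * J_norm x)" if "S \<in> finite_index_sets" for S
      using rho_le_J_norm[OF x that] by (auto simp: rho_scale intro: mult_left_mono)
    then show "c *\<^sub>R x \<in> J_hat X"
      using x X unfolding J_hat_def bdd by (auto simp: scaleR_fun_def intro: subspace_scale)
  qed
qed

section \<open>The limit map\<close>

text \<open>
  If \<open>x\<close> were not Cauchy, then from every index \<open>N\<close> one could move on to some \<open>n > N\<close> with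
  \<open>dist (x n) (x N) \<ge> e\<close>.  Iterating \<open>k\<close> times gives an index set with \<open>(\<rho> x S)\<^sup>2 \<ge> k e\<^sup>2\<close>.
\<close>

lemma J_hat_convergent:
  fixes x :: "nat \<Rightarrow> 'a::banach"
  assumes x: "x \<in> J_hat X"
  shows "convergent x"
proof (rule ccontr)
  assume "\<not> convergent x"
  then have "\<not> Cauchy x"
    by (simp add: Cauchy_convergent_iff)
  then obtain e where e: "e > 0" and far: "\<And>N. \<exists>n\<ge>N. e \<le> norm (x N - x n)"
    unfolding Cauchy_altdef2 by (metis dist_commute dist_norm not_le)
  have far': "\<exists>n>N. e \<le> norm (x N - x n)" for N
  proof -
    obtain n where n: "n \<ge> N" "e \<le> norm (x N - x n)"
      using far by blast
    then have "n \<noteq> N"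
      using e by auto
    with n show ?thesis
      by (auto simp: order_less_le)
  qed
  then obtain p where p: "\<And>i. p i < p (Suc i) \<and> e \<le> norm (x (p i) - x (p (Suc i)))"
    using dependent_nat_choice[of "\<lambda>_ _. True" "\<lambda>_ m n. m < n \<and> e \<le> norm (x m - x n)"] by auto
  then have mono: "strict_mono p"
    by (simp add: strict_mono_Suc_iff)
  have bound: "real k * e\<^sup>2 \<le> (sqrt 2 * J_norm x)\<^sup>2" for k
  proof -
    have "real k * e\<^sup>2 = (\<Sum>i=1..k. e\<^sup>2)"
      by simp
    also have "\<dots> \<le> (\<Sum>i=1..k. (norm (x (p (i - 1)) - x (p i)))\<^sup>2)"
    proof (intro sum_mono power_mono)
      fix i assume "i \<in> {1..k}"
      then show "e \<le> norm (x (p (i - 1)) - x (p i))"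
        using p[of "i - 1"] by simp
    qed (use e in simp)
    also have "\<dots> \<le> (rho x (p ` {0..k}))\<^sup>2"
      by (simp add: rho_strict_mono[OF mono] sum_nonneg)
    also have "\<dots> \<le> (sqrt 2 * J_norm x)\<^sup>2"
      using rho_le_J_norm[OF x, of "p ` {0..k}"]
      by (intro power_mono) (auto simp: finite_index_sets_def rho_eq_L2_set)
    finally show ?thesis .
  qed
  obtain k where "(sqrt 2 * J_norm x)\<^sup>2 < real k * e\<^sup>2"
    using e reals_Archimedean3[of "e\<^sup>2"] by auto
  then show False
    using bound[of k] by simp
qed

lemma J_hat_tendsto_lim:
  fixes x :: "nat \<Rightarrow> 'a::banach"
  shows "x \<in> J_hat X \<Longrightarrow> x \<longlonglongrightarrow> lim x"
  using J_hat_convergent by (simp add: convergent_LIMSEQ_iff)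

lemma bounded_linear_lim:
  fixes X :: "nat \<Rightarrow> 'a::banach set"
  shows "bounded_linear_between (J_hat X) J_norm UNIV norm lim"
proof -
  have "lim (x + y) = lim x + lim y" if "x \<in> J_hat X" "y \<in> J_hat X" for x y
    using tendsto_add[OF J_hat_tendsto_lim[OF that(1)] J_hat_tendsto_lim[OF that(2)]]
    by (simp add: limI plus_fun_def)
  moreover have "lim (c *\<^sub>R x) = c *\<^sub>R lim x" if "x \<in> J_hat X" for c x
    using tendsto_scaleR[OF tendsto_const J_hat_tendsto_lim[OF that]]
    by (simp add: limI scaleR_fun_def)
  moreover have "norm (lim x) \<le> sqrt 2 * J_norm x" if "x \<in> J_hat X" for x
    using tendsto_norm[OF J_hat_tendsto_lim[OF that]] norm_le_J_norm[OF that]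
    by (intro LIMSEQ_le_const2) auto
  ultimately show ?thesis
    unfolding bounded_linear_between_def by blast
qed

lemma J_space_eq_kernel_lim:
  fixes X :: "nat \<Rightarrow> 'a::banach set"
  shows "J_space X = {x \<in> J_hat X. lim x = 0}"
proof -
  have "(\<lambda>n. norm (x n)) \<longlonglongrightarrow> 0 \<longleftrightarrow> lim x = 0" if "x \<in> J_hat X" for x
    using J_hat_tendsto_lim[OF that] LIMSEQ_unique by (auto simp: tendsto_norm_zero_iff)
  then show ?thesis
    by (auto simp: J_space_def)
qed

section \<open>Partial sums of expansions\<close>

context
  fixes W :: "nat \<Rightarrow> 'a::banach set"
  assumes W: "schauder_decomposition W"
begin

lemma expansion_props: "expansion W z i \<in> W i" "expansion W z sums z"
proof -
  have "is_expansion W z (expansion W z)"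
    using W unfolding schauder_decomposition_def expansion_def by (metis theI')
  then show "expansion W z i \<in> W i" "expansion W z sums z"
    by (auto simp: is_expansion_def)
qed

lemma expansion_unique:
  assumes "\<And>i. w i \<in> W i" and "w sums z"
  shows "expansion W z = w"
proof -
  have "is_expansion W z w"
    using assms by (simp add: is_expansion_def)
  moreover have "\<exists>!w. is_expansion W z w"
    using W by (simp add: schauder_decomposition_def)
  ultimately show ?thesis
    unfolding expansion_def by (metis the1_equality)
qed

lemma W_subspace: "subspace (W i)"
  using W by (simp add: schauder_decomposition_def)

lemma expansion_add: "expansion W (y + z) = (\<lambda>i. expansion W y i + expansion W z i)"
  by (intro expansion_unique)
    (auto intro: subspace_add W_subspace expansion_props sums_add)

lemma expansion_diff: "expansion W (y - z) = (\<lambda>i. expansion W y i - expansion W z i)"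
  by (intro expansion_unique)
    (auto intro: subspace_diff W_subspace expansion_props sums_diff)

lemma expansion_scale: "expansion W (c *\<^sub>R z) = (\<lambda>i. c *\<^sub>R expansion W z i)"
  by (intro expansion_unique)
    (auto intro: subspace_scale W_subspace expansion_props sums_scaleR_right)

lemma expansion_block:
  assumes "finite A"
  shows "expansion W (\<Sum>i\<in>A. expansion W z i) = (\<lambda>i. if i \<in> A then expansion W z i else 0)"
  using assms
  by (intro expansion_unique)
    (auto intro: subspace_0 W_subspace expansion_props sums_If_finite_set)

text \<open>
  The remainder of \<open>z\<close> outside all blocks is appended as a further vector: it is disjoint from the
  blocks and makes the sum equal to \<open>z\<close>, which turns the estimate for the partial sums into one by
  the norm of \<open>z\<close> itself.
\<close>

lemma lower_2_estimate_blocks: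
  assumes M: "\<And>k (z::nat \<Rightarrow> 'a).
      disjoint_family_on (\<lambda>j. expansion_support W (z j)) {1..k} \<Longrightarrow>
      (\<Sum>j=1..k. (norm (z j))\<^sup>2) \<le> M * (norm (\<Sum>j=1..k. z j))\<^sup>2"
    and fin: "\<And>j::nat. j \<in> {1..k} \<Longrightarrow> finite (A j)"
    and disj: "disjoint_family_on A {1..k}"
  shows "(\<Sum>j=1..k. (norm (\<Sum>i\<in>A j. expansion W z i))\<^sup>2) \<le> M * (norm z)\<^sup>2"
proof -
  define P where "P B = (\<Sum>i\<in>B. expansion W z i)" for B
  define U where "U = (\<Union>j\<in>{1..k}. A j)"
  define y where "y j = (if j = Suc k then z - P U else P (A j))" for j
  have "finite U"
    using fin by (auto simp: U_def)
  have supp: "expansion_support W (y j) \<subseteq> (if j = Suc k then - U else A j)"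
    if "j \<in> {1..Suc k}" for j
    using that fin \<open>finite U\<close>
    by (auto simp: y_def P_def expansion_support_def expansion_diff expansion_block split: if_splits)
  have "expansion_support W (y i) \<inter> expansion_support W (y j) = {}"
    if i: "i \<in> {1..Suc k}" and j: "j \<in> {1..Suc k}" and "i \<noteq> j" for i j
  proof -
    have "A m \<subseteq> U" if "m \<in> {1..Suc k}" "m \<noteq> Suc k" for m
      unfolding U_def using that by (intro UN_upper) simp
    moreover have "A i \<inter> A j = {}" if "i \<noteq> Suc k" "j \<noteq> Suc k"
      using disj i j \<open>i \<noteq> j\<close> that by (intro disjoint_family_onD[of A "{1..k}"]) auto
    ultimately have "(if i = Suc k then - U else A i) \<inter> (if j = Suc k then - U else A j) = {}"
      using i j \<open>i \<noteq> j\<close> by auto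
    then show ?thesis
      using supp[OF i] supp[OF j] by blast
  qed
  then have "disjoint_family_on (\<lambda>j. expansion_support W (y j)) {1..Suc k}"
    unfolding disjoint_family_on_def by blast
  then have "(\<Sum>j=1..Suc k. (norm (y j))\<^sup>2) \<le> M * (norm (\<Sum>j=1..Suc k. y j))\<^sup>2"
    by (rule M)
  moreover have "(\<Sum>j=1..k. y j) = P U"
  proof -
    have "P U = (\<Sum>j\<in>{1..k}. P (A j))"
      unfolding P_def U_def using disj fin
      by (intro sum.UNION_disjoint) (auto simp: disjoint_family_on_def)
    then show ?thesis
      by (simp add: y_def)
  qed
  then have "(\<Sum>j=1..Suc k. y j) = z"
    by (simp add: y_def)
  moreover have "(\<Sum>j=1..k. (norm (P (A j)))\<^sup>2) \<le> (\<Sum>j=1..Suc k. (norm (y j))\<^sup>2)"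
    by (simp add: y_def)
  ultimately show ?thesis
    by (simp add: P_def)
qed

lemma aggregate_projection_linear: "linear (\<lambda>z n. aggregate_projection W n z)"
  by (rule linearI)
    (auto simp: aggregate_projection_def expansion_add expansion_scale fun_eq_iff scaleR_fun_def
      sum.distrib scaleR_sum_right)

lemma aggregate_projection_tendsto: "(\<lambda>n. aggregate_projection W n z) \<longlonglongrightarrow> z"
  using expansion_props(2)[of z] by (simp add: aggregate_projection_def sums_def)

text \<open>
  The differences of consecutive partial sums along \<open>p\<^sub>0 < \<dots> < p\<^sub>k\<close> are, up to sign, the
  projections onto the blocks of indices from \<open>p\<^bsub>j-1\<^esub>\<close> to \<open>p\<^sub>j - 1\<close>; the last term of \<open>\<rho>\<close> comes from
  the block of all indices below \<open>p\<^sub>k\<close>.  It overlaps the others, so the lower estimate is applied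
  twice.  The resulting factor 2 under the root cancels the factor \<open>1 / sqrt 2\<close> of the \<open>J\<close>-norm.
\<close>

lemma rho_aggregate_projection_le:
  assumes lower: "lower_2_estimate W"
  obtains C where "\<And>z S. rho (\<lambda>n. aggregate_projection W n z) S \<le> sqrt 2 * (C * norm z)"
proof -
  obtain M where M: "\<And>k (z::nat \<Rightarrow> 'a).
      disjoint_family_on (\<lambda>j. expansion_support W (z j)) {1..k} \<Longrightarrow>
      (\<Sum>j=1..k. (norm (z j))\<^sup>2) \<le> M * (norm (\<Sum>j=1..k. z j))\<^sup>2"
    using lower unfolding lower_2_estimate_def by blast
  have "rho (\<lambda>n. aggregate_projection W n z) S \<le> sqrt 2 * (sqrt M * norm z)" for z S
  proof -
    let ?a = "\<lambda>n. aggregate_projection W n z"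
    define l where "l = sorted_list_of_set S"
    define k where "k = card S - 1"
    define A where "A j = {l ! (j - 1)..<l ! j}" for j
    have le: "l ! i \<le> l ! j" if "i \<le> j" "j \<le> k" "1 \<le> j" for i j
      using that by (intro sorted_nth_mono) (auto simp: l_def k_def)
    have block: "norm (?a (l ! (j - 1)) - ?a (l ! j)) = norm (\<Sum>i\<in>A j. expansion W z i)"
      if "j \<in> {1..k}" for j
    proof -
      have "?a (l ! j) - ?a (l ! (j - 1)) = (\<Sum>i\<in>A j. expansion W z i)"
        using that le[of "j - 1" j]
        by (simp add: aggregate_projection_def A_def lessThan_atLeast0 sum_diff_nat_ivl)
      then show ?thesis
        by (metis norm_minus_commute)
    qed
    have "disjoint_family_on A {1..k}"
    proof -
      have "A i \<inter> A j = {}" if "i < j" "1 \<le> i" "j \<le> k" for i j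
        using that le[of i "j - 1"] by (fastforce simp: A_def)
      then show ?thesis
        unfolding disjoint_family_on_def
        by (metis Int_commute atLeastAtMost_iff linorder_neqE_nat)
    qed
    moreover have "finite (A j)" for j
      by (simp add: A_def)
    ultimately have "(\<Sum>j=1..k. (norm (\<Sum>i\<in>A j. expansion W z i))\<^sup>2) \<le> M * (norm z)\<^sup>2"
      by (intro lower_2_estimate_blocks M)
    moreover have "(norm (?a (l ! k)))\<^sup>2 \<le> M * (norm z)\<^sup>2"
      using lower_2_estimate_blocks[OF M, where k = 1 and A = "\<lambda>_. {..<l ! k}" and z = z]
      by (simp add: aggregate_projection_def disjoint_family_on_def)
    moreover have "(\<Sum>j=1..k. (norm (?a (l ! (j - 1)) - ?a (l ! j)))\<^sup>2) =
        (\<Sum>j=1..k. (norm (\<Sum>i\<in>A j. expansion W z i))\<^sup>2)"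
      by (intro sum.cong refl) (simp only: block)
    ultimately have "(\<Sum>j=1..k. (norm (?a (l ! (j - 1)) - ?a (l ! j)))\<^sup>2) + (norm (?a (l ! k)))\<^sup>2
        \<le> 2 * (M * (norm z)\<^sup>2)"
      by linarith
    then have "rho ?a S \<le> sqrt (2 * (M * (norm z)\<^sup>2))"
      unfolding rho_def Let_def l_def[symmetric] k_def[symmetric] by (rule real_sqrt_le_mono)
    then show ?thesis
      by (simp add: real_sqrt_mult)
  qed
  then show ?thesis
    using that by blast
qed

end

section \<open>The complement of the James-type space\<close>

theorem proposition6p2:
  fixes X W :: "nat \<Rightarrow> 'a::banach set"
    and T :: "'a \<Rightarrow> nat \<Rightarrow> 'a"
  assumes chain: "dense_subspace_chain X"
    and decomposition: "unconditional_schauder_decomposition W"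
    and lower: "lower_2_estimate W"
    and X_eq: "\<And>n. X n = block_sum W n"
    and T_def: "\<And>z. T z = (\<lambda>n. aggregate_projection W n z)"
  shows "(\<forall>z. T z \<in> J_hat X) \<and>
    linear T \<and>
    normed_embedding UNIV norm (J_hat X) J_norm T \<and>
    topological_direct_sum (J_hat X) J_norm (J_space X) (range T) \<and>
    normed_isomorphic (J_hat X) J_norm (J_space X \<times> (UNIV :: 'a set)) (sum_norm J_norm norm)"
proof -
  have W: "schauder_decomposition W"
    using decomposition by (simp add: unconditional_schauder_decomposition_def)
  obtain C where C: "\<And>z S. rho (T z) S \<le> sqrt 2 * (C * norm z)"
    using rho_aggregate_projection_le[OF W lower] unfolding T_def by blast
  have T_hat: "T z \<in> J_hat X" for z
  proof -
    have "T z n \<in> X n" for n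
      using expansion_props(1)[OF W]
      by (auto simp: T_def X_eq block_sum_def aggregate_projection_def)
    then show ?thesis
      using C[of z] by (auto simp: J_hat_def bdd_above_def)
  qed
  have lin: "linear T"
  proof -
    have "T = (\<lambda>z n. aggregate_projection W n z)"
      using T_def by (rule ext)
    then show ?thesis
      using aggregate_projection_linear[OF W] by simp
  qed
  have "J_norm (T z) \<le> C * norm z" for z
    using C by (rule J_norm_le)
  then have T_bounded: "bounded_linear_between UNIV norm (J_hat X) J_norm T"
    using T_hat lin by (auto simp: bounded_linear_between_def linear_add linear_scale)
  have left_inverse: "lim (T z) = z" for z
    using aggregate_projection_tendsto[OF W] unfolding T_def by (rule limI)
  have J_hat: "subspace (J_hat X)"
    using chain by (intro subspace_J_hat) (simp add: dense_subspace_chain_def)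
  note split = direct_sum_of_left_inverse[where N = J_norm and L = lim, OF J_hat
      J_norm_nonneg[where X = X] J_norm_add[where X = X] J_norm_minus T_bounded
      bounded_linear_lim left_inverse, folded J_space_eq_kernel_lim]
  show ?thesis
    using T_hat lin by (intro conjI allI split)
qed

end
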